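(* Let $Y$ and $Z$ be topological spaces. The following propositions are true. (1) If $Y$ is a regular locally compact space (or a regular locally $Z$-compact space), then the topologies $\tau(t(\tau(t^Z_{co})))$, $\tau(t(\tau(t^Z_1)))$ and $\tau(t(\tau(t^Z_{1,s})))$ on $\mathcal{O}_Z(Y)$ are admissible. (2) If $Y$ is a corecompact space (or a $Z$-corecompact space), then the topologies $\tau(t(\tau(t^Z_1)))$ and $\tau(t(\tau(t^Z_{1,s})))$ on $\mathcal{O}_Z(Y)$ are admissible. (3) If $Y$ is a locally bounded space (or a locally $Z$-bounded space), then the topology $\tau(t(\tau(t^Z_{1,s})))$ on $\mathcal{O}_Z(Y)$ is admissible.
   Context: For a topological space $X$, $\mathcal{O}(X)$ denotes the family of all open subsets of $X$. $C(Y,Z)$ is the set of all continuous maps from $Y$ to $Z$, and $\mathcal{O}_Z(Y)=\{f^{-1}(U): f\in C(Y,Z),\ U\in\mathcal{O}(Z)\}$. $\tau_Y^Z$ is the topology on $Y$ having $\mathcal{O}_Z(Y)$ as a subbasis. A subset $K\subseteq Y$ is $Z$-compact if it is compact in $(Y,\tau_Y^Z)$. $Y$ is locally $Z$-compact if $(Y,\tau_Y^Z)$ is locally compact. The topology $t_{co}^Z$ on $C(Y,Z)$ has as a subbasis all sets $(K,U)=\{f\in C(Y,Z): f(K)\subseteq U\}$ with $K\subseteq Y$ $Z$-compact and $U\in\mathcal{O}(Z)$. $\tau_1^Z$ is the family of all $\mathbb{H}\subseteq\mathcal{O}(Y)$ such that: ($\alpha$) if $A\in\mathbb{H}\cap\mathcal{O}_Z(Y)$,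 $V\in\mathcal{O}(Y)$ and $A\subseteq V$, then $V\in\mathbb{H}$; and ($\beta$) every collection of elements of $\mathcal{O}_Z(Y)$ whose union belongs to $\mathbb{H}$ has a finite subcollection whose union belongs to $\mathbb{H}$. $\tau_{1,s}^Z$ is the family of all $\mathbb{H}\subseteq\mathcal{O}(Y)$ satisfying ($\alpha$) and: ($\beta'$) every collection of elements of $\mathcal{O}_Z(Y)$ whose union equals $Y$ has a finite subcollection whose union belongs to $\mathbb{H}$. The topology $t_1^Z$ (respectively $t_{1,s}^Z$) on $C(Y,Z)$ has as a subbasis all sets $(\mathbb{H},U)=\{f\in C(Y,Z): f^{-1}(U)\in\mathbb{H}\}$ with $\mathbb{H}\in\tau_1^Z$ (respectively $\mathbb{H}\in\tau_{1,s}^Z$) and $U\in\mathcal{O}(Z)$. A subset $K$ of a space $X$ is bounded (in $X$) if every open cover of $X$ has a finite subcollection covering $K$. A space $X$ is corecompact if for every $x\in X$ and every open neighborhood $U$ of $x$ there is an open neighborhood $V\subseteq U$ of $x$ that is bounded in the space $U$. $X$ is locally bounded if for every $x\in X$ and every open neighborhood $U$ of $x$ there is a bounded open neighborhood $V\subseteq U$ of $x$. A subset of $Y$ is $Z$-bounded if it is bounded in $(Y,\tau_Y^Z)$. $Y$ is locally $Z$-bounded if for every $y\in Y$ and every open neighborhood $U$ of $y$ there is a $Z$-bounded neighborhood $g^{-1}(V)\in\mathcal{O}_Z(Y)$ of $y$ with $g^{-1}(V)\subseteq U$. $Y$ is $Z$-corecompact if for every $y\in Y$ and every open neighborhood $U$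 of $y$ in $Y$ there is a neighborhood $f^{-1}(V)\in\mathcal{O}_Z(Y)$ of $y$ with $f^{-1}(V)\subseteq U$ and $f^{-1}(V)$ bounded in $U$, where $U$ carries the topology $\{U\cap W: W\in\tau_Y^Z\}$. Dual topologies: for a topology $t$ on $C(Y,Z)$, $\tau(t)$ is the topology on $\mathcal{O}_Z(Y)$ having as a subbasis all sets $(\mathcal{H},U)=\{f^{-1}(U): f\in\mathcal{H}\}$ with $\mathcal{H}\in t$ and $U\in\mathcal{O}(Z)$. For a topology $\tau$ on $\mathcal{O}_Z(Y)$, $t(\tau)$ is the topology on $C(Y,Z)$ having as a subbasis all sets $(\mathbb{H},U)=\{f\in C(Y,Z): f^{-1}(U)\in\mathbb{H}\}$ with $\mathbb{H}\in\tau$ and $U\in\mathcal{O}(Z)$. Admissibility on $\mathcal{O}_Z(Y)$: for a space $X$ and a map $G:X\to C(Y,Z)$ let $\overline{G}:X\times\mathcal{O}(Z)\to\mathcal{O}_Z(Y)$, $\overline{G}(x,U)=(G(x))^{-1}(U)$, and $\widetilde{G}:X\times Y\to Z$, $\widetilde{G}(x,y)=G(x)(y)$. A map $M:X\times\mathcal{O}(Z)\to(\mathcal{O}_Z(Y),\tau)$ is continuous with respect to the first variable if for each fixed $U\in\mathcal{O}(Z)$ the map $x\mapsto M(x,U)$ from $X$ to $(\mathcal{O}_Z(Y),\tau)$ is continuous. A topology $\tau$ on $\mathcal{O}_Z(Y)$ is admissible if for every space $X$ and every map $G:X\to C(Y,Z)$, continuity with respect to the first variable of $\overline{G}:X\times\mathcal{O}(Z)\to(\mathcal{O}_Z(Y),\tau)$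 implies continuity of $\widetilde{G}:X\times Y\to Z$. *)

theory Defs
  imports "HOL-Analysis.Analysis"
begin

text \<open>Spaces are abstract topologies, so that \<open>Y\<close> and \<open>Z\<close> may be empty and several topologies can
  live on the same carrier.\<close>

text \<open>The carrier \<open>C\<close> is added as the intersection of the empty subfamily, so that the topology
  generated by a subbasis \<open>S\<close> always has \<open>C\<close> as its carrier.\<close>

definition subbasis_topology :: "'a set \<Rightarrow> 'a set set \<Rightarrow> 'a topology"
  where "subbasis_topology C S = topology_generated_by (insert C S)"

lemma topspace_subbasis_topology:
  "S \<subseteq> Pow C \<Longrightarrow> topspace (subbasis_topology C S) = C"
  by (auto simp: subbasis_topology_def)

text \<open>Maps are made extensional on the carrier of \<open>Y\<close>: two continuous maps that agree there are the
  same element of \<open>C(Y,Z)\<close>.\<close>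

definition cmaps :: "'a topology \<Rightarrow> 'b topology \<Rightarrow> ('a \<Rightarrow> 'b) set"
  where "cmaps Y Z = {f \<in> extensional (topspace Y). continuous_map Y Z f}"

definition preimage_on :: "'a topology \<Rightarrow> ('a \<Rightarrow> 'b) \<Rightarrow> 'b set \<Rightarrow> 'a set"
  where "preimage_on Y f U = {y \<in> topspace Y. f y \<in> U}"

definition Z_opens :: "'a topology \<Rightarrow> 'b topology \<Rightarrow> 'a set set"
  where "Z_opens Y Z = {preimage_on Y f U | f U. f \<in> cmaps Y Z \<and> openin Z U}"

definition Z_topology :: "'a topology \<Rightarrow> 'b topology \<Rightarrow> 'a topology"
  where "Z_topology Y Z = subbasis_topology (topspace Y) (Z_opens Y Z)"

definition Z_compact :: "'a topology \<Rightarrow> 'b topology \<Rightarrow> 'a set \<Rightarrow> bool"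
  where "Z_compact Y Z K \<longleftrightarrow> compactin (Z_topology Y Z) K"

text \<open>Local compactness is the neighbourhood-base condition: every open neighbourhood of a point
  contains a compact neighbourhood of it. The library's \<^const>\<open>locally_compact_space\<close> only asks
  for one compact neighbourhood of every point. For regular spaces the two agree, but the topology
  \<^term>\<open>Z_topology Y Z\<close> need not be regular when \<open>Y\<close> is.\<close>

definition loc_compact :: "'a topology \<Rightarrow> bool"
  where "loc_compact X \<longleftrightarrow> neighbourhood_base_of (compactin X) X"

lemma loc_compact_iff_locally_compact_space:
  "regular_space X \<Longrightarrow> loc_compact X \<longleftrightarrow> locally_compact_space X"
  by (simp add: loc_compact_def locally_compact_space_neighbourhood_base)

definition loc_Z_compact :: "'a topology \<Rightarrow> 'b topology \<Rightarrow> bool"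
  where "loc_Z_compact Y Z \<longleftrightarrow> loc_compact (Z_topology Y Z)"

definition bounded_in :: "'a topology \<Rightarrow> 'a set \<Rightarrow> bool"
  where "bounded_in X K \<longleftrightarrow> K \<subseteq> topspace X \<and>
    (\<forall>\<U>. (\<forall>U\<in>\<U>. openin X U) \<and> \<Union>\<U> = topspace X \<longrightarrow>
         (\<exists>\<F>. finite \<F> \<and> \<F> \<subseteq> \<U> \<and> K \<subseteq> \<Union>\<F>))"

definition corecompact :: "'a topology \<Rightarrow> bool"
  where "corecompact X \<longleftrightarrow>
    (\<forall>x U. openin X U \<and> x \<in> U \<longrightarrow>
       (\<exists>V. openin X V \<and> x \<in> V \<and> V \<subseteq> U \<and> bounded_in (subtopology X U) V))"

definition loc_bounded :: "'a topology \<Rightarrow> bool"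
  where "loc_bounded X \<longleftrightarrow>
    (\<forall>x U. openin X U \<and> x \<in> U \<longrightarrow>
       (\<exists>V. openin X V \<and> x \<in> V \<and> V \<subseteq> U \<and> bounded_in X V))"

definition Z_bounded :: "'a topology \<Rightarrow> 'b topology \<Rightarrow> 'a set \<Rightarrow> bool"
  where "Z_bounded Y Z K \<longleftrightarrow> bounded_in (Z_topology Y Z) K"

definition loc_Z_bounded :: "'a topology \<Rightarrow> 'b topology \<Rightarrow> bool"
  where "loc_Z_bounded Y Z \<longleftrightarrow>
    (\<forall>y U. openin Y U \<and> y \<in> U \<longrightarrow>
       (\<exists>V \<in> Z_opens Y Z. y \<in> V \<and> V \<subseteq> U \<and> Z_bounded Y Z V))"

definition Z_corecompact :: "'a topology \<Rightarrow> 'b topology \<Rightarrow> bool"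
  where "Z_corecompact Y Z \<longleftrightarrow>
    (\<forall>y U. openin Y U \<and> y \<in> U \<longrightarrow>
       (\<exists>V \<in> Z_opens Y Z. y \<in> V \<and> V \<subseteq> U \<and> bounded_in (subtopology (Z_topology Y Z) U) V))"

definition t_co :: "'a topology \<Rightarrow> 'b topology \<Rightarrow> ('a \<Rightarrow> 'b) topology"
  where "t_co Y Z = subbasis_topology (cmaps Y Z)
    {{f \<in> cmaps Y Z. f ` K \<subseteq> U} | K U. Z_compact Y Z K \<and> openin Z U}"

definition cond_alpha :: "'a topology \<Rightarrow> 'b topology \<Rightarrow> 'a set set \<Rightarrow> bool"
  where "cond_alpha Y Z H \<longleftrightarrow> (\<forall>A V. A \<in> H \<inter> Z_opens Y Z \<and> openin Y V \<and> A \<subseteq> V \<longrightarrow> V \<in> H)"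

definition tau_1 :: "'a topology \<Rightarrow> 'b topology \<Rightarrow> 'a set set set"
  where "tau_1 Y Z = {H. H \<subseteq> Collect (openin Y) \<and> cond_alpha Y Z H \<and>
    (\<forall>\<A>. \<A> \<subseteq> Z_opens Y Z \<and> \<Union>\<A> \<in> H \<longrightarrow>
         (\<exists>\<F>. finite \<F> \<and> \<F> \<subseteq> \<A> \<and> \<Union>\<F> \<in> H))}"

definition tau_1s :: "'a topology \<Rightarrow> 'b topology \<Rightarrow> 'a set set set"
  where "tau_1s Y Z = {H. H \<subseteq> Collect (openin Y) \<and> cond_alpha Y Z H \<and>
    (\<forall>\<A>. \<A> \<subseteq> Z_opens Y Z \<and> \<Union>\<A> = topspace Y \<longrightarrow>
         (\<exists>\<F>. finite \<F> \<and> \<F> \<subseteq> \<A> \<and> \<Union>\<F> \<in> H))}"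

definition maps_into :: "'a topology \<Rightarrow> 'b topology \<Rightarrow> 'a set set \<Rightarrow> 'b set \<Rightarrow> ('a \<Rightarrow> 'b) set"
  where "maps_into Y Z H U = {f \<in> cmaps Y Z. preimage_on Y f U \<in> H}"

definition t_1 :: "'a topology \<Rightarrow> 'b topology \<Rightarrow> ('a \<Rightarrow> 'b) topology"
  where "t_1 Y Z = subbasis_topology (cmaps Y Z)
    {maps_into Y Z H U | H U. H \<in> tau_1 Y Z \<and> openin Z U}"

definition t_1s :: "'a topology \<Rightarrow> 'b topology \<Rightarrow> ('a \<Rightarrow> 'b) topology"
  where "t_1s Y Z = subbasis_topology (cmaps Y Z)
    {maps_into Y Z H U | H U. H \<in> tau_1s Y Z \<and> openin Z U}"

text \<open>The dual topologies: \<open>tau_dual\<close> is \<open>\<tau>(t)\<close> and \<open>t_dual\<close> is \<open>t(\<tau>)\<close>. The first is meant for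
  topologies with carrier \<open>cmaps Y Z\<close>, the second for those with carrier \<open>Z_opens Y Z\<close>.\<close>

definition tau_dual ::
  "'a topology \<Rightarrow> 'b topology \<Rightarrow> ('a \<Rightarrow> 'b) topology \<Rightarrow> 'a set topology"
  where "tau_dual Y Z t = subbasis_topology (Z_opens Y Z)
    {(\<lambda>f. preimage_on Y f U) ` H | H U. openin t H \<and> openin Z U}"

definition t_dual ::
  "'a topology \<Rightarrow> 'b topology \<Rightarrow> 'a set topology \<Rightarrow> ('a \<Rightarrow> 'b) topology"
  where "t_dual Y Z \<tau> = subbasis_topology (cmaps Y Z)
    {maps_into Y Z H U | H U. openin \<tau> H \<and> openin Z U}"

text \<open>Admissibility quantifies over all spaces \<open>X\<close>. A definition cannot quantify over types, so the
  type carrying \<open>X\<close> is a parameter; a theorem concluding admissibility for an arbitrary type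
  parameter covers every space \<open>X\<close>.\<close>

definition Z_admissible ::
  "'x itself \<Rightarrow> 'a topology \<Rightarrow> 'b topology \<Rightarrow> 'a set topology \<Rightarrow> bool"
  where "Z_admissible _ Y Z \<tau> \<longleftrightarrow>
    (\<forall>(X :: 'x topology) G. G ` topspace X \<subseteq> cmaps Y Z \<longrightarrow>
       (\<forall>U. openin Z U \<longrightarrow> continuous_map X \<tau> (\<lambda>x. preimage_on Y (G x) U)) \<longrightarrow>
       continuous_map (prod_topology X Y) Z (\<lambda>(x, y). G x y))"

end

theory Submission
  imports Defs
begin

text \<open>Call a topology on \<open>C(Y,Z)\<close> admissible if it makes evaluation continuous. Dualising preserves
  admissibility in both directions, so it suffices that \<open>t_co\<close>, \<open>t_1\<close> and \<open>t_1s\<close> are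
  admissible. Each hypothesis on \<open>Y\<close> makes some topology \<open>T\<close>, either \<open>Y\<close> itself or
  \<open>Z_topology Y Z\<close>, locally compact, corecompact or locally bounded. The sets \<open>f\<^sup>-\<^sup>1(U)\<close> are open
  in \<open>T\<close>. Given \<open>y \<in> f\<^sup>-\<^sup>1(U)\<close>, a suitable neighbourhood \<open>V \<subseteq> f\<^sup>-\<^sup>1(U)\<close> of \<open>y\<close> in \<open>T\<close>
  then produces a subbasic neighbourhood of \<open>f\<close> consisting of maps sending \<open>V\<close> into \<open>U\<close>. For \<open>t_1\<close> it comes from
  the family of all \<open>W\<close> in which \<open>V\<close> is bounded, whose property \<open>\<beta>\<close> follows from the interpolation
  property of the way-below relation.\<close>

section \<open>Joint continuity and admissible topologies on \<open>C(Y,Z)\<close>\<close>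

text \<open>Boxes around points decide openness in the product, and a box
  \<open>N \<times> V\<close> is carried into \<open>U\<close> exactly when \<open>V\<close> lies in
  the preimage of \<open>U\<close> under every \<open>G x'\<close> with \<open>x'\<close> in
  \<open>N\<close>. The dual topologies see maps only through such preimages.\<close>

lemma continuous_map_prod_iff_preimage_on:
  assumes G: "G ` topspace X \<subseteq> cmaps Y Z"
  shows "continuous_map (prod_topology X Y) Z (\<lambda>(x, y). G x y) \<longleftrightarrow>
    (\<forall>U x y. openin Z U \<and> x \<in> topspace X \<and> y \<in> preimage_on Y (G x) U \<longrightarrow>
       (\<exists>N V. openin X N \<and> x \<in> N \<and> openin Y V \<and> y \<in> V \<and> (\<forall>x'\<in>N. V \<subseteq> preimage_on Y (G x') U)))"
    (is "?L \<longleftrightarrow> ?R")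
proof -
  have "(\<lambda>(x, y). G x y) \<in> topspace (prod_topology X Y) \<rightarrow> topspace Z"
    using G by (fastforce simp: cmaps_def continuous_map_def)
  then have "?L \<longleftrightarrow> (\<forall>U. openin Z U \<longrightarrow>
      openin (prod_topology X Y) {p \<in> topspace X \<times> topspace Y. (case p of (x, y) \<Rightarrow> G x y) \<in> U})"
    by (simp add: continuous_map_def)
  also have "\<dots> \<longleftrightarrow> ?R"
  proof (intro iffI allI impI)
    fix U x y
    assume L: "\<forall>U. openin Z U \<longrightarrow>
        openin (prod_topology X Y) {p \<in> topspace X \<times> topspace Y. (case p of (x, y) \<Rightarrow> G x y) \<in> U}"
      and h: "openin Z U \<and> x \<in> topspace X \<and> y \<in> preimage_on Y (G x) U"
    let ?S = "{p \<in> topspace X \<times> topspace Y. (case p of (x, y) \<Rightarrow> G x y) \<in> U}"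
    have "openin (prod_topology X Y) ?S" "(x, y) \<in> ?S"
      using L h by (auto simp: preimage_on_def)
    then have "\<exists>N V. openin X N \<and> openin Y V \<and> x \<in> N \<and> y \<in> V \<and> N \<times> V \<subseteq> ?S"
      by (rule openin_prod_topology_alt[THEN iffD1, rule_format])
    then obtain N V where "openin X N" "openin Y V" "x \<in> N" "y \<in> V" and sub: "N \<times> V \<subseteq> ?S"
      by (elim exE conjE)
    moreover have "\<forall>x'\<in>N. V \<subseteq> preimage_on Y (G x') U"
      using sub by (fastforce simp: preimage_on_def)
    ultimately show "\<exists>N V. openin X N \<and> x \<in> N \<and> openin Y V \<and> y \<in> V \<and>
        (\<forall>x'\<in>N. V \<subseteq> preimage_on Y (G x') U)"
      by blast
  next
    fix U
    assume R: ?R and U: "openin Z U"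
    let ?S = "{p \<in> topspace X \<times> topspace Y. (case p of (x, y) \<Rightarrow> G x y) \<in> U}"
    have "\<exists>N V. openin X N \<and> openin Y V \<and> x \<in> N \<and> y \<in> V \<and> N \<times> V \<subseteq> ?S"
      if "(x, y) \<in> ?S" for x y
    proof -
      have "x \<in> topspace X" "y \<in> preimage_on Y (G x) U"
        using that by (auto simp: preimage_on_def)
      with R U obtain N V where NV: "openin X N" "x \<in> N" "openin Y V" "y \<in> V"
        "\<forall>x'\<in>N. V \<subseteq> preimage_on Y (G x') U"
        by meson
      then have "N \<times> V \<subseteq> ?S"
        using openin_subset[OF NV(1)] by (auto simp: preimage_on_def)
      with NV show ?thesis by blast
    qed
    then show "openin (prod_topology X Y) ?S"
      by (intro openin_prod_topology_alt[THEN iffD2] allI impI)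
  qed
  finally show ?thesis .
qed

definition eval_admissible :: "'a topology \<Rightarrow> 'b topology \<Rightarrow> ('a \<Rightarrow> 'b) topology \<Rightarrow> bool"
  where "eval_admissible Y Z t \<longleftrightarrow> topspace t = cmaps Y Z \<and>
    continuous_map (prod_topology t Y) Z (\<lambda>(f, y). f y)"

text \<open>This is the criterion for joint continuity with \<open>X = t\<close> and
  \<open>G\<close> the identity.\<close>

lemma eval_admissible_iff:
  "eval_admissible Y Z t \<longleftrightarrow> topspace t = cmaps Y Z \<and>
    (\<forall>U f y. openin Z U \<and> f \<in> cmaps Y Z \<and> y \<in> preimage_on Y f U \<longrightarrow>
       (\<exists>H V. openin t H \<and> f \<in> H \<and> openin Y V \<and> y \<in> V \<and> (\<forall>g\<in>H. V \<subseteq> preimage_on Y g U)))"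
  unfolding eval_admissible_def
  using continuous_map_prod_iff_preimage_on[of "\<lambda>f. f" t Y Z] by auto

section \<open>Subbases and transfer of admissibility to the dual topologies\<close>

lemma openin_subbasis_topology: "U \<in> S \<Longrightarrow> openin (subbasis_topology C S) U"
  by (auto simp: subbasis_topology_def intro: topology_generated_by_Basis)

lemma topspace_t_co: "topspace (t_co Y Z) = cmaps Y Z"
  unfolding t_co_def by (intro topspace_subbasis_topology) auto

lemma topspace_t_1: "topspace (t_1 Y Z) = cmaps Y Z"
  unfolding t_1_def by (intro topspace_subbasis_topology) (auto simp: maps_into_def)

lemma topspace_t_1s: "topspace (t_1s Y Z) = cmaps Y Z"
  unfolding t_1s_def by (intro topspace_subbasis_topology) (auto simp: maps_into_def)

lemma topspace_t_dual: "topspace (t_dual Y Z \<tau>) = cmaps Y Z"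
  unfolding t_dual_def by (intro topspace_subbasis_topology) (auto simp: maps_into_def)

text \<open>Continuity of evaluation gives a neighbourhood \<open>H\<close> of \<open>G x\<close>.
  The preimages of \<open>U\<close> under members of \<open>H\<close> form a subbasic open set,
  which continuity in the first variable pulls back to a neighbourhood of \<open>x\<close>.\<close>

lemma Z_admissible_tau_dual:
  assumes "eval_admissible Y Z t"
  shows "Z_admissible TYPE('x) Y Z (tau_dual Y Z t)"
  unfolding Z_admissible_def
proof (intro allI impI)
  fix X :: "'x topology" and G
  assume G: "G ` topspace X \<subseteq> cmaps Y Z"
    and cont: "\<forall>U. openin Z U \<longrightarrow> continuous_map X (tau_dual Y Z t) (\<lambda>x. preimage_on Y (G x) U)"
  show "continuous_map (prod_topology X Y) Z (\<lambda>(x, y). G x y)"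
    unfolding continuous_map_prod_iff_preimage_on[OF G]
  proof (intro allI impI, elim conjE)
    fix U x y
    assume U: "openin Z U" and x: "x \<in> topspace X" and y: "y \<in> preimage_on Y (G x) U"
    obtain H V where H: "openin t H" "G x \<in> H" and V: "openin Y V" "y \<in> V"
      and HV: "\<forall>g\<in>H. V \<subseteq> preimage_on Y g U"
      using assms[unfolded eval_admissible_iff, THEN conjunct2, rule_format, of U "G x" y] U x y G
      by blast
    let ?HU = "(\<lambda>f. preimage_on Y f U) ` H"
    \<comment> \<open>For \<open>x'\<close> in \<open>?N\<close> the map \<open>G x'\<close> need
      not belong to \<open>H\<close>; it suffices that it has the same preimage of \<open>U\<close>
      as some member of \<open>H\<close>.\<close>
    let ?N = "{x' \<in> topspace X. preimage_on Y (G x') U \<in> ?HU}"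
    have "openin (tau_dual Y Z t) ?HU"
      unfolding tau_dual_def using H U by (intro openin_subbasis_topology) blast
    then have "openin X ?N"
      using cont U by (auto intro: openin_continuous_map_preimage)
    moreover have "x \<in> ?N" using x H by blast
    moreover have "\<forall>x'\<in>?N. V \<subseteq> preimage_on Y (G x') U" using HV by auto
    ultimately show "\<exists>N V. openin X N \<and> x \<in> N \<and> openin Y V \<and> y \<in> V \<and>
        (\<forall>x'\<in>N. V \<subseteq> preimage_on Y (G x') U)"
      using V by blast
  qed
qed

text \<open>Admissibility of \<open>\<tau>\<close> is applied to the space \<open>X = C(Y,Z)\<close> with the topology \<open>t(\<tau>)\<close>
  and \<open>G\<close> the identity.\<close>

lemma eval_admissible_t_dual:
  fixes Y :: "'a topology" and Z :: "'b topology"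
  assumes adm: "Z_admissible TYPE('a \<Rightarrow> 'b) Y Z \<tau>" and top: "topspace \<tau> = Z_opens Y Z"
  shows "eval_admissible Y Z (t_dual Y Z \<tau>)"
proof -
  have "continuous_map (t_dual Y Z \<tau>) \<tau> (\<lambda>f. preimage_on Y f U)" if "openin Z U" for U
  proof -
    have "openin (t_dual Y Z \<tau>) {f \<in> cmaps Y Z. preimage_on Y f U \<in> H}" if "openin \<tau> H" for H
      using that \<open>openin Z U\<close> unfolding t_dual_def maps_into_def
      by (intro openin_subbasis_topology) blast
    with that top show ?thesis
      by (auto simp: continuous_map_def topspace_t_dual Z_opens_def)
  qed
  then show ?thesis
    using adm by (auto simp: eval_admissible_def Z_admissible_def topspace_t_dual)
qed

lemma topspace_tau_dual:
  "topspace t = cmaps Y Z \<Longrightarrow> topspace (tau_dual Y Z t) = Z_opens Y Z"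
  unfolding tau_dual_def
  by (intro topspace_subbasis_topology) (use openin_subset in \<open>fastforce simp: Z_opens_def\<close>)

text \<open>\<open>Z_admissible_tau_dual\<close> is used at two types of test spaces: at
  \<open>'a \<Rightarrow> 'b\<close> to make \<open>t_dual\<close> admissible, and then at
  \<open>'x\<close> for the conclusion.\<close>

lemma Z_admissible_tau_t_tau:
  assumes "eval_admissible Y Z t"
  shows "Z_admissible TYPE('x) Y Z (tau_dual Y Z (t_dual Y Z (tau_dual Y Z t)))"
proof -
  have "topspace t = cmaps Y Z" using assms by (simp add: eval_admissible_def)
  then show ?thesis
    by (intro Z_admissible_tau_dual eval_admissible_t_dual topspace_tau_dual assms)
qed

section \<open>Topologies between \<open>Z_topology Y Z\<close> and \<open>Y\<close>\<close>

lemma openin_Z_opens: "V \<in> Z_opens Y Z \<Longrightarrow> openin Y V"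
  by (auto simp: Z_opens_def preimage_on_def cmaps_def intro: openin_continuous_map_preimage)

lemma topspace_Z_topology: "topspace (Z_topology Y Z) = topspace Y"
  unfolding Z_topology_def
  by (intro topspace_subbasis_topology) (auto simp: Z_opens_def preimage_on_def)

lemma openin_Z_topology_Z_opens: "V \<in> Z_opens Y Z \<Longrightarrow> openin (Z_topology Y Z) V"
  unfolding Z_topology_def by (rule openin_subbasis_topology)

text \<open>A generated topology is the coarsest one containing its generators. The carrier
  hypothesis takes care of the generator \<open>topspace Y\<close> inserted by
  \<open>subbasis_topology\<close>.\<close>

lemma openin_Z_topology_coarsest:
  assumes "topspace T = topspace Y" "\<forall>V\<in>Z_opens Y Z. openin T V" "openin (Z_topology Y Z) V"
  shows "openin T V"
proof (rule generate_topology_on_coarsest[OF istopology_openin])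
  show "generate_topology_on (insert (topspace Y) (Z_opens Y Z)) V"
    using assms(3)
    by (simp add: Z_topology_def subbasis_topology_def openin_topology_generated_by_iff)
  show "openin T S" if "S \<in> insert (topspace Y) (Z_opens Y Z)" for S
    using assms(1,2) that openin_topspace[of T] by auto
qed

lemma openin_Z_topology_imp_openin: "openin (Z_topology Y Z) V \<Longrightarrow> openin Y V"
  by (rule openin_Z_topology_coarsest) (auto intro: openin_Z_opens)

text \<open>One argument for such a \<open>T\<close> covers both the plain condition on
  \<open>Y\<close> and its \<open>Z\<close>-version.\<close>

definition between_Z :: "'a topology \<Rightarrow> 'b topology \<Rightarrow> 'a topology \<Rightarrow> bool"
  where "between_Z Y Z T \<longleftrightarrow> topspace T = topspace Y \<and>
    (\<forall>V. openin T V \<longrightarrow> openin Y V) \<and> (\<forall>V\<in>Z_opens Y Z. openin T V)"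

lemma between_Z_self: "between_Z Y Z Y"
  by (simp add: between_Z_def openin_Z_opens)

lemma between_Z_Z_topology: "between_Z Y Z (Z_topology Y Z)"
  by (simp add: between_Z_def topspace_Z_topology openin_Z_topology_Z_opens
      openin_Z_topology_imp_openin)

lemma preimage_on_Z_opens: "f \<in> cmaps Y Z \<Longrightarrow> openin Z U \<Longrightarrow> preimage_on Y f U \<in> Z_opens Y Z"
  by (auto simp: Z_opens_def)

section \<open>Relative boundedness and interpolation\<close>

text \<open>Covers by open sets of \<open>T\<close> restrict to \<open>W\<close>, and relatively
  open covers lift. For open \<open>V\<close> and \<open>W\<close> the right side says that
  \<open>V\<close> is way below \<open>W\<close> in the lattice of open sets of
  \<open>T\<close>.\<close>

lemma bounded_in_subtopology:
  assumes "W \<subseteq> topspace T"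
  shows "bounded_in (subtopology T W) V \<longleftrightarrow> V \<subseteq> W \<and>
    (\<forall>\<U>. (\<forall>U\<in>\<U>. openin T U) \<and> W \<subseteq> \<Union>\<U> \<longrightarrow> (\<exists>\<F>. finite \<F> \<and> \<F> \<subseteq> \<U> \<and> V \<subseteq> \<Union>\<F>))"
    (is "?L \<longleftrightarrow> V \<subseteq> W \<and> ?R")
proof
  assume L: ?L
  have VW: "V \<subseteq> W" using L by (simp add: bounded_in_def)
  have "\<exists>\<F>. finite \<F> \<and> \<F> \<subseteq> \<U> \<and> V \<subseteq> \<Union>\<F>" if \<U>: "\<forall>U\<in>\<U>. openin T U" "W \<subseteq> \<Union>\<U>" for \<U>
  proof -
    let ?\<U> = "(\<inter>) W ` \<U>"
    have "\<forall>U\<in>?\<U>. openin (subtopology T W) U" "\<Union>?\<U> = topspace (subtopology T W)"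
      using \<U> assms by (auto simp: openin_subtopology_Int2)
    with L obtain \<G> where "finite \<G>" "\<G> \<subseteq> ?\<U>" and V: "V \<subseteq> \<Union>\<G>"
      unfolding bounded_in_def by blast
    then obtain \<F> where "finite \<F>" "\<F> \<subseteq> \<U>" "\<G> = (\<inter>) W ` \<F>"
      by (meson finite_subset_image)
    with V show ?thesis by (intro exI[of _ \<F>]) auto
  qed
  then show "V \<subseteq> W \<and> ?R" by (intro conjI VW allI impI) (elim conjE)
next
  assume R: "V \<subseteq> W \<and> ?R"
  have "\<exists>\<F>. finite \<F> \<and> \<F> \<subseteq> \<U> \<and> V \<subseteq> \<Union>\<F>"
    if \<U>: "\<forall>U\<in>\<U>. openin (subtopology T W) U" "\<Union>\<U> = topspace (subtopology T W)" for \<U>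
  proof -
    \<comment> \<open>Taking every open set whose trace on \<open>W\<close> is in
      \<open>\<U>\<close> lifts the cover without choosing one extension per member.\<close>
    let ?\<W> = "{S. openin T S \<and> S \<inter> W \<in> \<U>}"
    have "W \<subseteq> \<Union>?\<W>"
    proof
      fix x assume "x \<in> W"
      then obtain U where "U \<in> \<U>" "x \<in> U" using \<U>(2) assms by auto
      with \<U>(1) show "x \<in> \<Union>?\<W>" by (force simp: openin_subtopology)
    qed
    then have "\<exists>\<G>. finite \<G> \<and> \<G> \<subseteq> ?\<W> \<and> V \<subseteq> \<Union>\<G>"
      using R[THEN conjunct2, rule_format, of ?\<W>] by simp
    then obtain \<G> where "finite \<G>" "\<G> \<subseteq> ?\<W>" "V \<subseteq> \<Union>\<G>"
      by (elim exE conjE)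
    then show ?thesis
      using R by (intro exI[of _ "(\<lambda>S. S \<inter> W) ` \<G>"]) auto
  qed
  with R assms show ?L by (auto simp: bounded_in_def)
qed

text \<open>A cover of \<open>W\<close> also covers \<open>B\<close>, and a finite part covering
  \<open>A\<close> also covers \<open>V\<close>.\<close>

lemma bounded_in_subtopology_mono:
  assumes "bounded_in (subtopology T B) A" "V \<subseteq> A" "B \<subseteq> W" "W \<subseteq> topspace T"
  shows "bounded_in (subtopology T W) V"
proof -
  have B: "B \<subseteq> topspace T" using assms by blast
  show ?thesis
    unfolding bounded_in_subtopology[OF assms(4)]
  proof (intro conjI allI impI)
    show "V \<subseteq> W" using assms(1-3) by (auto simp: bounded_in_def)
    fix \<U> assume "(\<forall>U\<in>\<U>. openin T U) \<and> W \<subseteq> \<Union>\<U>"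
    then have "(\<forall>U\<in>\<U>. openin T U) \<and> B \<subseteq> \<Union>\<U>" using assms(3) by blast
    then obtain \<F> where "finite \<F>" "\<F> \<subseteq> \<U>" "A \<subseteq> \<Union>\<F>"
      using assms(1) unfolding bounded_in_subtopology[OF B] by metis
    with assms(2) show "\<exists>\<F>. finite \<F> \<and> \<F> \<subseteq> \<U> \<and> V \<subseteq> \<Union>\<F>"
      by (intro exI[of _ \<F>]) simp
  qed
qed

lemma bounded_in_subtopology_Union:
  assumes "finite I" "\<And>i. i \<in> I \<Longrightarrow> bounded_in (subtopology T W) (A i)"
  shows "bounded_in (subtopology T W) (\<Union>(A ` I))"
  unfolding bounded_in_def
proof (intro conjI allI impI)
  show "\<Union>(A ` I) \<subseteq> topspace (subtopology T W)"
    using assms(2) unfolding bounded_in_def by blast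
  fix \<U>
  assume "(\<forall>U\<in>\<U>. openin (subtopology T W) U) \<and> \<Union>\<U> = topspace (subtopology T W)"
  then have "\<forall>i\<in>I. \<exists>\<F>. finite \<F> \<and> \<F> \<subseteq> \<U> \<and> A i \<subseteq> \<Union>\<F>"
    using assms(2) by (simp add: bounded_in_def)
  from bchoice[OF this] obtain \<F>
    where "\<forall>i\<in>I. finite (\<F> i) \<and> \<F> i \<subseteq> \<U> \<and> A i \<subseteq> \<Union>(\<F> i)"
    by (elim exE)
  then show "\<exists>\<G>. finite \<G> \<and> \<G> \<subseteq> \<U> \<and> \<Union>(A ` I) \<subseteq> \<Union>\<G>"
    using assms(1) by (intro exI[of _ "\<Union>(\<F> ` I)"]) fastforce
qed

text \<open>Corecompactness applied twice puts open sets \<open>A\<close> and \<open>B\<close>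
  around each point of \<open>W\<close>, with \<open>A\<close> bounded in \<open>B\<close> and
  \<open>B\<close> bounded in \<open>W\<close>. Finitely many of the \<open>A\<close> cover
  \<open>V\<close>, and the union of their partners \<open>B\<close> interpolates.\<close>

lemma corecompact_interpolation:
  assumes T: "corecompact T" and W: "openin T W" and V: "bounded_in (subtopology T W) V"
  obtains B where "B \<subseteq> W" "bounded_in (subtopology T B) V" "bounded_in (subtopology T W) B"
proof -
  \<comment> \<open>Working with pairs keeps a partner \<open>B\<close> attached to each
    \<open>A\<close> of the finite subcover.\<close>
  let ?P = "\<lambda>(A, B). openin T A \<and> bounded_in (subtopology T B) A \<and> bounded_in (subtopology T W) B"
  have WT: "W \<subseteq> topspace T" by (rule openin_subset[OF W])
  let ?\<A> = "fst ` {p. ?P p}"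
  have "W \<subseteq> \<Union>?\<A>"
  proof
    fix x assume "x \<in> W"
    with T W obtain B where B: "openin T B" "x \<in> B" "bounded_in (subtopology T W) B"
      unfolding corecompact_def by meson
    with T obtain A where "openin T A" "x \<in> A" "bounded_in (subtopology T B) A"
      unfolding corecompact_def by meson
    with B show "x \<in> \<Union>?\<A>" by force
  qed
  moreover have "\<forall>A\<in>?\<A>. openin T A" by auto
  ultimately obtain \<F> where "finite \<F>" "\<F> \<subseteq> ?\<A>" and V\<F>: "V \<subseteq> \<Union>\<F>"
    using V unfolding bounded_in_subtopology[OF WT] by meson
  then obtain I where I: "finite I" "I \<subseteq> {p. ?P p}" "\<F> = fst ` I"
    by (meson finite_subset_image)
  let ?B = "\<Union>(snd ` I)"
  have BW: "bounded_in (subtopology T W) ?B"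
    using I by (intro bounded_in_subtopology_Union) auto
  then have sub: "?B \<subseteq> W" by (simp add: bounded_in_def)
  have "bounded_in (subtopology T ?B) (fst p)" if "p \<in> I" for p
  proof (rule bounded_in_subtopology_mono)
    show "bounded_in (subtopology T (snd p)) (fst p)" using that I by auto
  qed (use that sub WT in auto)
  then have "bounded_in (subtopology T ?B) (\<Union>(fst ` I))"
    by (intro bounded_in_subtopology_Union I(1))
  then have "bounded_in (subtopology T ?B) V"
    using V\<F> I(3) sub WT by (auto intro: bounded_in_subtopology_mono)
  with sub BW that show thesis by blast
qed

section \<open>Comparison of the local conditions\<close>

text \<open>A compact \<open>K\<close> between \<open>V\<close> and \<open>U\<close> turns every
  open cover of \<open>U\<close> into a finite cover of \<open>V\<close>.\<close>

lemma loc_compact_imp_corecompact: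
  assumes "loc_compact T"
  shows "corecompact T"
  unfolding corecompact_def
proof (intro allI impI, elim conjE)
  fix x U assume U: "openin T U" "x \<in> U"
  then obtain V K where V: "openin T V" "x \<in> V" "V \<subseteq> K" and K: "compactin T K" "K \<subseteq> U"
    using assms unfolding loc_compact_def neighbourhood_base_of by meson
  have "bounded_in (subtopology T U) V"
    unfolding bounded_in_subtopology[OF openin_subset[OF U(1)]]
  proof (intro conjI allI impI)
    show "V \<subseteq> U" using V K by blast
    fix \<U> assume "(\<forall>S\<in>\<U>. openin T S) \<and> U \<subseteq> \<Union>\<U>"
    then have "\<exists>\<F>. finite \<F> \<and> \<F> \<subseteq> \<U> \<and> K \<subseteq> \<Union>\<F>"
      using K unfolding compactin_def by (meson subset_trans)
    then show "\<exists>\<F>. finite \<F> \<and> \<F> \<subseteq> \<U> \<and> V \<subseteq> \<Union>\<F>" using V(3) by blast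
  qed
  with V K show "\<exists>V. openin T V \<and> x \<in> V \<and> V \<subseteq> U \<and> bounded_in (subtopology T U) V" by blast
qed

lemma corecompact_imp_loc_bounded:
  assumes "corecompact T"
  shows "loc_bounded T"
  unfolding loc_bounded_def
proof (intro allI impI)
  fix x U assume U: "openin T U \<and> x \<in> U"
  then obtain V where V: "openin T V" "x \<in> V" "V \<subseteq> U" "bounded_in (subtopology T U) V"
    using assms unfolding corecompact_def by meson
  then have "bounded_in (subtopology T (topspace T)) V"
    using U by (intro bounded_in_subtopology_mono[OF V(4)]) (auto dest: openin_subset)
  with V show "\<exists>V. openin T V \<and> x \<in> V \<and> V \<subseteq> U \<and> bounded_in T V" by auto
qed

text \<open>The hypothesis treats all open sets of \<open>Y\<close>, among them those of
  \<open>Z_topology Y Z\<close>, and its witnesses are open in the latter.\<close>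

lemma Z_corecompact_imp_corecompact: "Z_corecompact Y Z \<Longrightarrow> corecompact (Z_topology Y Z)"
  unfolding Z_corecompact_def corecompact_def
  by (meson openin_Z_topology_Z_opens openin_Z_topology_imp_openin)

lemma loc_Z_bounded_imp_loc_bounded: "loc_Z_bounded Y Z \<Longrightarrow> loc_bounded (Z_topology Y Z)"
  unfolding loc_Z_bounded_def loc_bounded_def Z_bounded_def
  by (meson openin_Z_topology_Z_opens openin_Z_topology_imp_openin)

section \<open>Admissibility of \<open>t_co\<close>, \<open>t_1\<close> and
  \<open>t_1s\<close>\<close>

text \<open>Compactness passes to the coarser topology \<open>Z_topology Y Z\<close>, so compact
  sets of \<open>T\<close> may be used in the subbasis of \<open>t_co\<close>.\<close>

lemma compactin_imp_Z_compact:
  assumes T: "between_Z Y Z T" and K: "compactin T K"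
  shows "Z_compact Y Z K"
  unfolding Z_compact_def compactin_def
proof (intro conjI allI impI)
  show "K \<subseteq> topspace (Z_topology Y Z)"
    using assms by (simp add: compactin_def between_Z_def topspace_Z_topology)
  fix \<U> assume "Ball \<U> (openin (Z_topology Y Z)) \<and> K \<subseteq> \<Union>\<U>"
  then have "Ball \<U> (openin T) \<and> K \<subseteq> \<Union>\<U>"
    using T openin_Z_topology_coarsest[of T Y Z] by (auto simp: between_Z_def)
  then show "\<exists>\<F>. finite \<F> \<and> \<F> \<subseteq> \<U> \<and> K \<subseteq> \<Union>\<F>"
    using K by (simp add: compactin_def)
qed

lemma eval_admissible_t_co:
  assumes T: "between_Z Y Z T" and lc: "loc_compact T"
  shows "eval_admissible Y Z (t_co Y Z)"
  unfolding eval_admissible_iff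
proof (intro conjI topspace_t_co allI impI, elim conjE)
  fix U f y
  assume U: "openin Z U" and f: "f \<in> cmaps Y Z" and y: "y \<in> preimage_on Y f U"
  have "openin T (preimage_on Y f U)"
    using T preimage_on_Z_opens[OF f U] by (simp add: between_Z_def)
  then obtain V K where V: "openin T V" "y \<in> V" "V \<subseteq> K"
    and K: "compactin T K" "K \<subseteq> preimage_on Y f U"
    using lc y unfolding loc_compact_def neighbourhood_base_of by meson
  let ?H = "{g \<in> cmaps Y Z. g ` K \<subseteq> U}"
  have "openin (t_co Y Z) ?H"
    unfolding t_co_def using U compactin_imp_Z_compact[OF T K(1)]
    by (intro openin_subbasis_topology) blast
  moreover have "f \<in> ?H" using f K by (auto simp: preimage_on_def)
  moreover have "openin Y V" using T V by (simp add: between_Z_def)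
  moreover have "\<forall>g\<in>?H. V \<subseteq> preimage_on Y g U"
    using V openin_subset[OF \<open>openin Y V\<close>] by (auto simp: preimage_on_def)
  ultimately show "\<exists>H V. openin (t_co Y Z) H \<and> f \<in> H \<and> openin Y V \<and> y \<in> V \<and>
      (\<forall>g\<in>H. V \<subseteq> preimage_on Y g U)"
    using V(2) by blast
qed

lemma tau_1I:
  assumes "H \<subseteq> Collect (openin Y)"
    and "\<And>A V. A \<in> H \<Longrightarrow> A \<in> Z_opens Y Z \<Longrightarrow> openin Y V \<Longrightarrow> A \<subseteq> V \<Longrightarrow> V \<in> H"
    and "\<And>\<A>. \<A> \<subseteq> Z_opens Y Z \<Longrightarrow> \<Union>\<A> \<in> H \<Longrightarrow> \<exists>\<F>. finite \<F> \<and> \<F> \<subseteq> \<A> \<and> \<Union>\<F> \<in> H"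
  shows "H \<in> tau_1 Y Z"
  unfolding tau_1_def cond_alpha_def mem_Collect_eq
  by (intro conjI allI impI assms(1))
     (elim conjE IntE, erule (3) assms(2), elim conjE, erule (1) assms(3))

lemma tau_1sI:
  assumes "H \<subseteq> Collect (openin Y)"
    and "\<And>A V. A \<in> H \<Longrightarrow> A \<in> Z_opens Y Z \<Longrightarrow> openin Y V \<Longrightarrow> A \<subseteq> V \<Longrightarrow> V \<in> H"
    and "\<And>\<A>. \<A> \<subseteq> Z_opens Y Z \<Longrightarrow> \<Union>\<A> = topspace Y \<Longrightarrow>
      \<exists>\<F>. finite \<F> \<and> \<F> \<subseteq> \<A> \<and> \<Union>\<F> \<in> H"
  shows "H \<in> tau_1s Y Z"
  unfolding tau_1s_def cond_alpha_def mem_Collect_eq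
  by (intro conjI allI impI assms(1))
     (elim conjE IntE, erule (3) assms(2), elim conjE, erule (1) assms(3))

lemma bounded_family_in_tau_1:
  assumes T: "between_Z Y Z T" and cc: "corecompact T"
  shows "{W. openin Y W \<and> bounded_in (subtopology T W) V} \<in> tau_1 Y Z" (is "?H \<in> _")
proof (rule tau_1I)
  show "?H \<subseteq> Collect (openin Y)" by blast
next
  fix A W assume A: "A \<in> ?H" "openin Y W" "A \<subseteq> W"
  then have "W \<subseteq> topspace T" using T openin_subset by (auto simp: between_Z_def)
  with A show "W \<in> ?H"
    using bounded_in_subtopology_mono[of T A V V W] by simp
next
  fix \<A> assume A: "\<A> \<subseteq> Z_opens Y Z" "\<Union>\<A> \<in> ?H"
  then have op: "\<forall>A\<in>\<A>. openin T A" using T by (auto simp: between_Z_def)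
  then have W: "openin T (\<Union>\<A>)" by (intro openin_Union) blast
  \<comment> \<open>Extracting a finite cover of \<open>V\<close> itself would only give containment
    in \<open>\<Union>\<F>\<close>. Covering the interpolant \<open>B\<close> makes \<open>V\<close>
    bounded in \<open>\<Union>\<F>\<close>.\<close>
  then obtain B where B: "bounded_in (subtopology T B) V" "bounded_in (subtopology T (\<Union>\<A>)) B"
    using corecompact_interpolation[OF cc W, of V] A(2) by blast
  then obtain \<F> where F: "finite \<F>" "\<F> \<subseteq> \<A>" "B \<subseteq> \<Union>\<F>"
    using op unfolding bounded_in_subtopology[OF openin_subset[OF W]] by (meson order_refl)
  have UF: "openin T (\<Union>\<F>)" using op F(2) by (intro openin_Union) blast
  then have "openin Y (\<Union>\<F>)" using T by (simp add: between_Z_def)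
  moreover have "bounded_in (subtopology T (\<Union>\<F>)) V"
    by (rule bounded_in_subtopology_mono[OF B(1) order_refl F(3) openin_subset[OF UF]])
  ultimately have "\<Union>\<F> \<in> ?H" by simp
  with F show "\<exists>\<F>. finite \<F> \<and> \<F> \<subseteq> \<A> \<and> \<Union>\<F> \<in> ?H" by blast
qed

lemma eval_admissible_t_1:
  assumes T: "between_Z Y Z T" and cc: "corecompact T"
  shows "eval_admissible Y Z (t_1 Y Z)"
  unfolding eval_admissible_iff
proof (intro conjI topspace_t_1 allI impI, elim conjE)
  fix U f y
  assume U: "openin Z U" and f: "f \<in> cmaps Y Z" and y: "y \<in> preimage_on Y f U"
  have P: "preimage_on Y f U \<in> Z_opens Y Z" by (rule preimage_on_Z_opens[OF f U])
  then have "openin T (preimage_on Y f U)" using T by (simp add: between_Z_def)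
  then obtain V where V: "openin T V" "y \<in> V" "bounded_in (subtopology T (preimage_on Y f U)) V"
    using cc y unfolding corecompact_def by meson
  let ?H = "{W. openin Y W \<and> bounded_in (subtopology T W) V}"
  have "openin (t_1 Y Z) (maps_into Y Z ?H U)"
    unfolding t_1_def using U bounded_family_in_tau_1[OF T cc]
    by (intro openin_subbasis_topology) blast
  moreover have "f \<in> maps_into Y Z ?H U"
    using f V(3) openin_Z_opens[OF P] by (simp add: maps_into_def)
  moreover have "openin Y V" using T V by (simp add: between_Z_def)
  \<comment> \<open>Boundedness in a subspace includes containment in it.\<close>
  moreover have "\<forall>g\<in>maps_into Y Z ?H U. V \<subseteq> preimage_on Y g U"
    by (auto simp: maps_into_def bounded_in_def)
  ultimately show "\<exists>H V. openin (t_1 Y Z) H \<and> f \<in> H \<and> openin Y V \<and> y \<in> V \<and>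
      (\<forall>g\<in>H. V \<subseteq> preimage_on Y g U)"
    using V(2) by blast
qed

text \<open>Condition \<open>\<beta>'\<close> concerns only covers of all of \<open>Y\<close> and
  these are open covers of \<open>T\<close>, so boundedness in \<open>T\<close> supplies the finite
  subfamily without interpolation.\<close>

lemma superset_family_in_tau_1s:
  assumes T: "between_Z Y Z T" and V: "bounded_in T V"
  shows "{W. openin Y W \<and> V \<subseteq> W} \<in> tau_1s Y Z" (is "?H \<in> _")
proof (rule tau_1sI)
  fix \<A> assume A: "\<A> \<subseteq> Z_opens Y Z" "\<Union>\<A> = topspace Y"
  then have "(\<forall>A\<in>\<A>. openin T A) \<and> \<Union>\<A> = topspace T" using T by (auto simp: between_Z_def)
  then obtain \<F> where F: "finite \<F>" "\<F> \<subseteq> \<A>" "V \<subseteq> \<Union>\<F>"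
    using V unfolding bounded_in_def by meson
  have "openin Y (\<Union>\<F>)"
    using A(1) F(2) by (intro openin_Union) (blast intro: openin_Z_opens)
  with F show "\<exists>\<F>. finite \<F> \<and> \<F> \<subseteq> \<A> \<and> \<Union>\<F> \<in> ?H" by blast
qed auto

lemma eval_admissible_t_1s:
  assumes T: "between_Z Y Z T" and lb: "loc_bounded T"
  shows "eval_admissible Y Z (t_1s Y Z)"
  unfolding eval_admissible_iff
proof (intro conjI topspace_t_1s allI impI, elim conjE)
  fix U f y
  assume U: "openin Z U" and f: "f \<in> cmaps Y Z" and y: "y \<in> preimage_on Y f U"
  have P: "preimage_on Y f U \<in> Z_opens Y Z" by (rule preimage_on_Z_opens[OF f U])
  then have "openin T (preimage_on Y f U)" using T by (simp add: between_Z_def)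
  then obtain V where V: "openin T V" "y \<in> V" "V \<subseteq> preimage_on Y f U" "bounded_in T V"
    using lb y unfolding loc_bounded_def by meson
  let ?H = "{W. openin Y W \<and> V \<subseteq> W}"
  have "openin (t_1s Y Z) (maps_into Y Z ?H U)"
    unfolding t_1s_def using U superset_family_in_tau_1s[OF T V(4)]
    by (intro openin_subbasis_topology) blast
  moreover have "f \<in> maps_into Y Z ?H U"
    using f V(3) openin_Z_opens[OF P] by (simp add: maps_into_def)
  moreover have "openin Y V" using T V by (simp add: between_Z_def)
  moreover have "\<forall>g\<in>maps_into Y Z ?H U. V \<subseteq> preimage_on Y g U"
    by (auto simp: maps_into_def)
  ultimately show "\<exists>H V. openin (t_1s Y Z) H \<and> f \<in> H \<and> openin Y V \<and> y \<in> V \<and>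
      (\<forall>g\<in>H. V \<subseteq> preimage_on Y g U)"
    using V(2) by blast
qed

theorem corollary3p3:
  fixes Y :: "'a topology" and Z :: "'b topology"
  shows "(regular_space Y \<and> loc_compact Y \<or> regular_space Y \<and> loc_Z_compact Y Z \<longrightarrow>
            Z_admissible TYPE('x) Y Z (tau_dual Y Z (t_dual Y Z (tau_dual Y Z (t_co Y Z)))) \<and>
            Z_admissible TYPE('x) Y Z (tau_dual Y Z (t_dual Y Z (tau_dual Y Z (t_1 Y Z)))) \<and>
            Z_admissible TYPE('x) Y Z (tau_dual Y Z (t_dual Y Z (tau_dual Y Z (t_1s Y Z))))) \<and>
         (corecompact Y \<or> Z_corecompact Y Z \<longrightarrow>
            Z_admissible TYPE('x) Y Z (tau_dual Y Z (t_dual Y Z (tau_dual Y Z (t_1 Y Z)))) \<and>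
            Z_admissible TYPE('x) Y Z (tau_dual Y Z (t_dual Y Z (tau_dual Y Z (t_1s Y Z))))) \<and>
         (loc_bounded Y \<or> loc_Z_bounded Y Z \<longrightarrow>
            Z_admissible TYPE('x) Y Z (tau_dual Y Z (t_dual Y Z (tau_dual Y Z (t_1s Y Z)))))"
proof -
  \<comment> \<open>Hiding \<open>T\<close> merges the two alternatives of each hypothesis. The
    implications between the local conditions keep the same witness.\<close>
  let ?between = "\<lambda>P. \<exists>T. between_Z Y Z T \<and> P T"
  have lc: "?between loc_compact"
    if "regular_space Y \<and> loc_compact Y \<or> regular_space Y \<and> loc_Z_compact Y Z"
    using that between_Z_self between_Z_Z_topology unfolding loc_Z_compact_def by blast
  have cc: "?between corecompact" if "corecompact Y \<or> Z_corecompact Y Z"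
    using that between_Z_self between_Z_Z_topology Z_corecompact_imp_corecompact by blast
  have lb: "?between loc_bounded" if "loc_bounded Y \<or> loc_Z_bounded Y Z"
    using that between_Z_self between_Z_Z_topology loc_Z_bounded_imp_loc_bounded by blast
  have lc_cc: "?between corecompact" if "?between loc_compact"
    using that loc_compact_imp_corecompact by blast
  have cc_lb: "?between loc_bounded" if "?between corecompact"
    using that corecompact_imp_loc_bounded by blast
  have t_co: "eval_admissible Y Z (t_co Y Z)" if "?between loc_compact"
    using that eval_admissible_t_co by blast
  have t_1: "eval_admissible Y Z (t_1 Y Z)" if "?between corecompact"
    using that eval_admissible_t_1 by blast
  have t_1s: "eval_admissible Y Z (t_1s Y Z)" if "?between loc_bounded"
    using that eval_admissible_t_1s by blast
  show ?thesis
    \<comment> \<open>Six goals about \<open>eval_admissible\<close> remain. In each,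
      \<open>assumption\<close> selects the rule matching the hypothesis at hand.\<close>
    by (intro conjI impI Z_admissible_tau_t_tau)
       (rule t_co[OF lc] t_1[OF lc_cc[OF lc]] t_1s[OF cc_lb[OF lc_cc[OF lc]]]
          t_1[OF cc] t_1s[OF cc_lb[OF cc]] t_1s[OF lb], assumption)+
qed

end
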